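(* Let $(a_n)_{n\ge 0}$, $(b_n)_{n\ge 0}$, $(c_n)_{n\ge 0}$ be sequences of complex numbers with $b_0=1$, $a_n\ne 0$ and $c_n\ne 0$ for all $n\ge 0$. Let $\mathscr{A}$ be the infinite lower triangular matrix with entries $\mathscr{A}_{n,k}=a_kb_{n-k}c_n$ for $n\ge k\ge 0$ (and $0$ for $k>n$). Then the matrix inverse $\mathscr{A}^{-1}$ belongs to $SDR_\infty$.
   Context: All matrices are infinite lower triangular matrices $\mathscr{A}=(A_{n,k})_{n\ge k\ge 0}$ with complex entries; we set $A_{n,k}=0$ whenever $k>n$. For an integer $m\ge 3$, $\mathscr{A}$ is called an SDR-matrix of order $m$ (written $\mathscr{A}\in SDR_m$) if for all integers $n,k\ge 0$, all $2\le p\le m-1$ and all $0\le r\le p-1$, $$\prod_{i=0}^{r}A_{n+i,k+r-i}\prod_{i=0}^{p-r-1}A_{n+p-i,k+r+i+1}=\prod_{i=0}^{r}A_{n+p-i,k+p-r+i}\prod_{i=0}^{p-r-1}A_{n+i,k+p-r-i-1}.$$ $SDR_\infty$ denotes the set of matrices lying in $SDR_m$ for every $m\ge 3$. *)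

theory Defs
  imports Complex_Main "HOL-Algebra.Group"
begin

definition lower_triangular :: "(nat \<Rightarrow> nat \<Rightarrow> complex) \<Rightarrow> bool" where
  "lower_triangular A \<longleftrightarrow> (\<forall>n k. n < k \<longrightarrow> A n k = 0)"

text \<open>The product \<open>\<Sum>j. A n j * B j k\<close> runs over all \<open>j\<close>; for a lower triangular \<open>A\<close> the
  terms with \<open>j > n\<close> vanish, so the finite sum below is the whole row-by-column product.\<close>

definition LT :: "(nat \<Rightarrow> nat \<Rightarrow> complex) monoid" where
  "LT = \<lparr>carrier = {A. lower_triangular A},
         monoid.mult = (\<lambda>A B n k. \<Sum>j\<le>n. A n j * B j k),
         one = (\<lambda>n k. if n = k then 1 else 0)\<rparr>"

lemma monoid_LT: "monoid LT"
proof (rule monoidI)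
  fix A B C assume A: "A \<in> carrier LT" and B: "B \<in> carrier LT" and C: "C \<in> carrier LT"
  show "A \<otimes>\<^bsub>LT\<^esub> B \<in> carrier LT"
    using A B by (auto simp: LT_def lower_triangular_def intro!: sum.neutral)
  have ext: "(\<Sum>j\<le>l. B l j * C j k) = (\<Sum>j\<le>n. B l j * C j k)" if "l \<le> n" for l n k
    by (rule sum.mono_neutral_left) (use that B in \<open>auto simp: LT_def lower_triangular_def\<close>)
  have "(\<Sum>j\<le>n. (\<Sum>l\<le>n. A n l * B l j) * C j k) = (\<Sum>l\<le>n. A n l * (\<Sum>j\<le>l. B l j * C j k))"
    for n k
  proof -
    have "(\<Sum>j\<le>n. (\<Sum>l\<le>n. A n l * B l j) * C j k) =
      (\<Sum>j\<le>n. \<Sum>l\<le>n. A n l * (B l j * C j k))"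
      by (simp add: sum_distrib_right mult.assoc)
    also have "\<dots> = (\<Sum>l\<le>n. A n l * (\<Sum>j\<le>n. B l j * C j k))"
      by (subst sum.swap) (simp add: sum_distrib_left)
    also have "\<dots> = (\<Sum>l\<le>n. A n l * (\<Sum>j\<le>l. B l j * C j k))"
      by (rule sum.cong) (auto simp: ext)
    finally show ?thesis .
  qed
  then show "(A \<otimes>\<^bsub>LT\<^esub> B) \<otimes>\<^bsub>LT\<^esub> C = A \<otimes>\<^bsub>LT\<^esub> (B \<otimes>\<^bsub>LT\<^esub> C)"
    by (simp add: LT_def)
next
  show "\<one>\<^bsub>LT\<^esub> \<in> carrier LT" by (auto simp: LT_def lower_triangular_def)
next
  fix A assume A: "A \<in> carrier LT"
  have "(\<Sum>j\<le>n. (if n = j then 1 else 0) * A j k) = A n k" for n k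
    by (simp add: if_distrib[of "\<lambda>x. x * _"] cong: if_cong)
  then show "\<one>\<^bsub>LT\<^esub> \<otimes>\<^bsub>LT\<^esub> A = A" by (simp add: LT_def)
  have "(\<Sum>j\<le>n. A n j * (if j = k then 1 else 0)) = A n k" for n k
    using A by (auto simp: LT_def lower_triangular_def if_distrib cong: if_cong)
  then show "A \<otimes>\<^bsub>LT\<^esub> \<one>\<^bsub>LT\<^esub> = A" by (simp add: LT_def)
qed

text \<open>All subtractions are between naturals with the first argument at least as large, so
  truncation never occurs. The notion is meant for \<open>m \<ge> 3\<close>.\<close>

definition SDR :: "nat \<Rightarrow> (nat \<Rightarrow> nat \<Rightarrow> complex) set" where
  "SDR m = {A. lower_triangular A \<and>
     (\<forall>n k p r. 2 \<le> p \<and> p \<le> m - 1 \<and> r \<le> p - 1 \<longrightarrow>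
        (\<Prod>i=0..r. A (n + i) (k + r - i)) * (\<Prod>i=0..p-r-1. A (n + p - i) (k + r + i + 1)) =
        (\<Prod>i=0..r. A (n + p - i) (k + p - r + i)) * (\<Prod>i=0..p-r-1. A (n + i) (k + p - r - i - 1)))}"

definition SDR_infinity :: "(nat \<Rightarrow> nat \<Rightarrow> complex) set" where
  "SDR_infinity = (\<Inter>m\<in>{3..}. SDR m)"

end

theory Submission
  imports Defs "HOL-Computational_Algebra.Formal_Power_Series"
begin

text \<open>Such an \<open>A\<close> is a Toeplitz matrix with symbol \<open>\<Sum>n. b n * X^n\<close>, with rows scaled by \<open>c\<close> and
  columns by \<open>a\<close>. Multiplying scaled Toeplitz matrices whose adjacent scalings cancel multiplies the
  symbols, so \<open>A\<close> has an inverse of the same kind. Every scaled Toeplitz matrix lies in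
  \<open>SDR_infinity\<close>: both sides of each defining identity use every row \<open>n, \<dots>, n + p\<close> and every
  column \<open>k, \<dots>, k + p\<close> exactly once, and the differences row minus column on the two sides
  agree as multisets.\<close>

text \<open>With a power series as symbol, convolution and inversion of coefficient sequences become
  \<open>*\<close> and \<open>inverse\<close> on \<open>fps\<close>.\<close>

definition scaled_toeplitz ::
  "(nat \<Rightarrow> complex) \<Rightarrow> complex fps \<Rightarrow> (nat \<Rightarrow> complex) \<Rightarrow> nat \<Rightarrow> nat \<Rightarrow> complex" where
  "scaled_toeplitz u F v = (\<lambda>n k. if k \<le> n then u n * fps_nth F (n - k) * v k else 0)"

lemma scaled_toeplitz_in_carrier: "scaled_toeplitz u F v \<in> carrier LT"
  by (simp add: LT_def lower_triangular_def scaled_toeplitz_def)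

lemma scaled_toeplitz_one:
  assumes "\<And>n. u n * v n = 1"
  shows "scaled_toeplitz u 1 v = \<one>\<^bsub>LT\<^esub>"
  using assms by (auto simp: LT_def scaled_toeplitz_def fun_eq_iff)

lemma scaled_toeplitz_mult:
  assumes "\<And>j. v j * u' j = 1"
  shows "scaled_toeplitz u F v \<otimes>\<^bsub>LT\<^esub> scaled_toeplitz u' G v' = scaled_toeplitz u (F * G) v'"
proof -
  have "(\<Sum>j\<le>n. scaled_toeplitz u F v n j * scaled_toeplitz u' G v' j k) =
      scaled_toeplitz u (F * G) v' n k" for n k
  proof (cases "k \<le> n")
    case True
    \<comment> \<open>Commuting the factors puts \<open>G\<close> at the summation index, which
      suits the substitution \<open>i = j - k\<close> below.\<close>
    have conv: "fps_nth (F * G) m = (\<Sum>i=0..m. fps_nth G i * fps_nth F (m - i))" for m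
      by (subst mult.commute) (rule fps_mult_nth)
    have "(\<Sum>j\<le>n. scaled_toeplitz u F v n j * scaled_toeplitz u' G v' j k) =
        (\<Sum>j=k..n. scaled_toeplitz u F v n j * scaled_toeplitz u' G v' j k)"
      by (rule sum.mono_neutral_right) (auto simp: scaled_toeplitz_def)
    also have "\<dots> = (\<Sum>j=k..n. u n * v' k * (fps_nth G (j - k) * fps_nth F (n - j)))"
    proof (rule sum.cong[OF refl])
      fix j assume "j \<in> {k..n}"
      then have "scaled_toeplitz u F v n j * scaled_toeplitz u' G v' j k =
          u n * v' k * (fps_nth G (j - k) * fps_nth F (n - j)) * (v j * u' j)"
        by (simp add: scaled_toeplitz_def mult_ac)
      then show "scaled_toeplitz u F v n j * scaled_toeplitz u' G v' j k =
          u n * v' k * (fps_nth G (j - k) * fps_nth F (n - j))"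
        by (simp add: assms)
    qed
    also have "\<dots> = (\<Sum>i=0..n-k. u n * v' k * (fps_nth G i * fps_nth F (n - k - i)))"
      by (rule sum.reindex_bij_witness[of _ "\<lambda>i. i + k" "\<lambda>j. j - k"]) (use True in auto)
    also have "\<dots> = scaled_toeplitz u (F * G) v' n k"
      using True conv by (simp add: scaled_toeplitz_def mult_ac flip: sum_distrib_left)
    finally show ?thesis .
  next
    case False
    then show ?thesis by (auto simp: scaled_toeplitz_def intro!: sum.neutral)
  qed
  then show ?thesis by (simp add: LT_def)
qed

text \<open>The hypothesis is pointwise on \<open>i \<le> r\<close>, so index expressions with
  natural subtraction can be compared where no truncation occurs.\<close>

lemma prod_atLeast0AtMost_rev:
  fixes f g :: "nat \<Rightarrow> 'a::comm_monoid_mult"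
  assumes "\<And>i. i \<le> r \<Longrightarrow> f i = g (r - i)"
  shows "(\<Prod>i=0..r. f i) = (\<Prod>i=0..r. g i)"
  by (rule prod.reindex_bij_witness[of _ "\<lambda>i. r - i" "\<lambda>i. r - i"]) (auto simp: assms)

text \<open>Counting \<open>r + 1\<close> indices up from \<open>0\<close> and \<open>p - r\<close>
  indices down from \<open>p\<close> tiles \<open>{0..p}\<close>.\<close>

lemma prod_split_at_both_ends:
  fixes f :: "nat \<Rightarrow> 'a::comm_monoid_mult"
  assumes "r < p"
  shows "(\<Prod>i=0..r. f i) * (\<Prod>i=0..p-r-1. f (p - i)) = (\<Prod>i=0..p. f i)"
proof -
  have "(\<Prod>i=0..p-r-1. f (p - i)) = (\<Prod>i=r+1..p. f i)"
    by (rule prod.reindex_bij_witness[of _ "\<lambda>i. p - i" "\<lambda>i. p - i"]) (use assms in auto)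
  moreover have "{0..p} = {0..r} \<union> {r+1..p}" using assms by auto
  ultimately show ?thesis by (simp add: prod.union_disjoint)
qed

text \<open>Each of the four products runs along an antidiagonal. An entry splits into a row factor,
  a column factor and a function of row minus column, and these three contributions are compared
  separately.\<close>

lemma scaled_toeplitz_SDR:
  fixes u v :: "nat \<Rightarrow> complex" and F :: "complex fps"
  defines "A \<equiv> scaled_toeplitz u F v"
  assumes "r < p"
  shows "(\<Prod>i=0..r. A (n + i) (k + r - i)) * (\<Prod>i=0..p-r-1. A (n + p - i) (k + r + i + 1)) =
    (\<Prod>i=0..r. A (n + p - i) (k + p - r + i)) * (\<Prod>i=0..p-r-1. A (n + i) (k + p - r - i - 1))"
proof -
  \<comment> \<open>The second product on each side has \<open>q + 1\<close> factors, and
    \<open>p = q + r + 1\<close> is symmetric in \<open>q\<close> and \<open>r\<close>.\<close>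
  define q where "q = p - r - 1"
  have p: "p = q + r + 1" using assms by (simp add: q_def)
  \<comment> \<open>The value \<open>0\<close> at negative arguments lets the factorization
    \<open>A\<close> hold above the diagonal too, without case distinctions.\<close>
  define e where "e z = (if 0 \<le> z then fps_nth F (nat z) else 0)" for z :: int
  have A: "A n k = u n * v k * e (int n - int k)" for n k
    by (simp add: A_def scaled_toeplitz_def e_def nat_diff_distrib flip: of_nat_diff)
  have split: "(\<Prod>i=0..r. f i) * (\<Prod>i=0..q. f (p - i)) = (\<Prod>i=0..p. f i)"
    "(\<Prod>i=0..r. f (p - i)) * (\<Prod>i=0..q. f i) = (\<Prod>i=0..p. f i)"
    for f :: "nat \<Rightarrow> complex"
    using prod_split_at_both_ends[of r p f] prod_split_at_both_ends[of q p f]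
    by (simp_all only: p mult.commute) simp_all
  \<comment> \<open>Rebracketing \<open>(m + p) - i\<close> as \<open>m + (p - i)\<close> exposes
    the argument \<open>p - i\<close> that \<open>split\<close> expects.\<close>
  have end_shift: "(\<Prod>i=0..s. f (m + p - i)) = (\<Prod>i=0..s. f (m + (p - i)))"
    if "s \<le> p" for f :: "nat \<Rightarrow> complex" and m s
    by (rule prod.cong) (use that in auto)
  have rp: "r \<le> p" and qp: "q \<le> p" by (simp_all add: p)
  have rows_l: "(\<Prod>i=0..r. u (n + i)) * (\<Prod>i=0..q. u (n + p - i)) = (\<Prod>i=0..p. u (n + i))"
    unfolding end_shift[OF qp] by (rule split)
  have rows_r: "(\<Prod>i=0..r. u (n + p - i)) * (\<Prod>i=0..q. u (n + i)) = (\<Prod>i=0..p. u (n + i))"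
    unfolding end_shift[OF rp] by (rule split)
  \<comment> \<open>The substitutions \<open>i\<close> to \<open>r - i\<close> and \<open>i\<close>
    to \<open>q - i\<close> bring the columns into the form required by
    \<open>split\<close>.\<close>
  have rev_l: "(\<Prod>i=0..r. v (k + r - i)) = (\<Prod>i=0..r. v (k + i))"
    "(\<Prod>i=0..q. v (k + r + i + 1)) = (\<Prod>i=0..q. v (k + (p - i)))"
    by (rule prod_atLeast0AtMost_rev; rule arg_cong[of _ _ v]; simp add: p)+
  have cols_l: "(\<Prod>i=0..r. v (k + r - i)) * (\<Prod>i=0..q. v (k + r + i + 1)) =
      (\<Prod>i=0..p. v (k + i))"
    unfolding rev_l by (rule split)
  have rev_r: "(\<Prod>i=0..r. v (k + p - r + i)) = (\<Prod>i=0..r. v (k + (p - i)))"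
    "(\<Prod>i=0..q. v (k + p - r - i - 1)) = (\<Prod>i=0..q. v (k + i))"
    by (rule prod_atLeast0AtMost_rev; rule arg_cong[of _ _ v]; simp add: p)+
  have cols_r: "(\<Prod>i=0..r. v (k + p - r + i)) * (\<Prod>i=0..q. v (k + p - r - i - 1)) =
      (\<Prod>i=0..p. v (k + i))"
    unfolding rev_r by (rule split)
  \<comment> \<open>In the first equation the differences are \<open>n - k - r + 2*i\<close> and
    \<open>n - k + r - 2*i\<close>, exchanged by \<open>i\<close> to \<open>r - i\<close>; the
    second works likewise with \<open>q\<close>.\<close>
  have diffs: "(\<Prod>i=0..r. e (int (n + i) - int (k + r - i))) =
      (\<Prod>i=0..r. e (int (n + p - i) - int (k + p - r + i)))"
    "(\<Prod>i=0..q. e (int (n + p - i) - int (k + r + i + 1))) =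
      (\<Prod>i=0..q. e (int (n + i) - int (k + p - r - i - 1)))"
    by (rule prod_atLeast0AtMost_rev; rule arg_cong[of _ _ e]; simp add: p)+
  have "(\<Prod>i=0..r. A (n + i) (k + r - i)) * (\<Prod>i=0..q. A (n + p - i) (k + r + i + 1)) =
      ((\<Prod>i=0..r. u (n + i)) * (\<Prod>i=0..q. u (n + p - i))) *
      ((\<Prod>i=0..r. v (k + r - i)) * (\<Prod>i=0..q. v (k + r + i + 1))) *
      ((\<Prod>i=0..r. e (int (n + i) - int (k + r - i))) *
       (\<Prod>i=0..q. e (int (n + p - i) - int (k + r + i + 1))))"
    by (simp only: A prod.distrib mult_ac)
  also have "\<dots> =
      ((\<Prod>i=0..r. u (n + p - i)) * (\<Prod>i=0..q. u (n + i))) *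
      ((\<Prod>i=0..r. v (k + p - r + i)) * (\<Prod>i=0..q. v (k + p - r - i - 1))) *
      ((\<Prod>i=0..r. e (int (n + p - i) - int (k + p - r + i))) *
       (\<Prod>i=0..q. e (int (n + i) - int (k + p - r - i - 1))))"
    by (simp only: rows_l rows_r cols_l cols_r diffs)
  also have "\<dots> =
      (\<Prod>i=0..r. A (n + p - i) (k + p - r + i)) * (\<Prod>i=0..q. A (n + i) (k + p - r - i - 1))"
    by (simp only: A prod.distrib mult_ac)
  finally show ?thesis by (simp only: q_def)
qed

lemma scaled_toeplitz_in_SDR_infinity: "scaled_toeplitz u F v \<in> SDR_infinity"
proof -
  have "scaled_toeplitz u F v \<in> SDR m" for m
    unfolding SDR_def mem_Collect_eq
  proof (intro conjI allI impI)
    show "lower_triangular (scaled_toeplitz u F v)"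
      by (simp add: lower_triangular_def scaled_toeplitz_def)
  next
    fix n k p r :: nat
    assume "2 \<le> p \<and> p \<le> m - 1 \<and> r \<le> p - 1"
    then show "(\<Prod>i=0..r. scaled_toeplitz u F v (n + i) (k + r - i)) *
        (\<Prod>i=0..p-r-1. scaled_toeplitz u F v (n + p - i) (k + r + i + 1)) =
        (\<Prod>i=0..r. scaled_toeplitz u F v (n + p - i) (k + p - r + i)) *
        (\<Prod>i=0..p-r-1. scaled_toeplitz u F v (n + i) (k + p - r - i - 1))"
      by (intro scaled_toeplitz_SDR) auto
  qed
  then show ?thesis by (simp add: SDR_infinity_def)
qed

theorem theorem2p1:
  fixes a b c :: "nat \<Rightarrow> complex" and A :: "nat \<Rightarrow> nat \<Rightarrow> complex"
  assumes "b 0 = 1"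
    and "\<And>n. a n \<noteq> 0"
    and "\<And>n. c n \<noteq> 0"
    and "A = (\<lambda>n k. if k \<le> n then a k * b (n - k) * c n else 0)"
  shows "A \<in> Units LT \<and> inv\<^bsub>LT\<^esub> A \<in> SDR_infinity"
proof -
  interpret monoid LT by (rule monoid_LT)
  define F where "F = Abs_fps b"
  \<comment> \<open>\<open>A\<close> is diagonal \<open>c\<close> times Toeplitz \<open>F\<close>
    times diagonal \<open>a\<close>; inverting the three factors in reverse order gives
    \<open>B\<close>.\<close>
  define B where "B = scaled_toeplitz (\<lambda>n. 1 / a n) (inverse F) (\<lambda>k. 1 / c k)"
  \<comment> \<open>\<open>b 0 = 1\<close> makes the constant coefficient of \<open>F\<close>
    nonzero, so \<open>inverse F\<close> is a genuine inverse.\<close>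
  have F: "inverse F * F = 1" "F * inverse F = 1"
    using assms(1) by (simp_all add: F_def inverse_mult_eq_1 inverse_mult_eq_1')
  have A: "A = scaled_toeplitz c F a"
    by (simp add: assms(4) scaled_toeplitz_def F_def fun_eq_iff)
  have carr: "A \<in> carrier LT" "B \<in> carrier LT"
    by (simp_all add: A B_def scaled_toeplitz_in_carrier)
  have AB: "A \<otimes>\<^bsub>LT\<^esub> B = \<one>\<^bsub>LT\<^esub>"
    unfolding A B_def using assms(2,3) by (simp add: scaled_toeplitz_mult scaled_toeplitz_one F)
  have BA: "B \<otimes>\<^bsub>LT\<^esub> A = \<one>\<^bsub>LT\<^esub>"
    unfolding A B_def using assms(2,3) by (simp add: scaled_toeplitz_mult scaled_toeplitz_one F)
  have "A \<in> Units LT" using carr AB BA by (auto simp: Units_def)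
  moreover have "inv\<^bsub>LT\<^esub> A = B" using inv_unique'[OF carr AB BA] by simp
  ultimately show ?thesis by (simp add: B_def scaled_toeplitz_in_SDR_infinity)
qed

end
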